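(* For any number of agents, there does not exist any deterministic algorithm that solves exploration with partial termination of 1-interval connected anonymous rings of unknown size $n$ by anonymous agents. This holds even if the agents have common chirality and the scheduler is fully synchronous ($\mathcal{FSYNC}$).
   Context: Ring: the nodes $v_0,\dots,v_{n-1}$ (indices modulo $n$) form a cycle; $v_i$ is linked to $v_{i-1}$ and $v_{i+1}$ via distinctly labelled ports $q_{i-}$ and $q_{i+}$ (labels need not be globally consistent). Time proceeds in rounds; in each round at most one edge, chosen by an adversary, is missing (1-interval connected ring). The ring is anonymous if nodes have no distinguishable identifiers. 'Unknown size' means the algorithm has no information on $n$ (not even an upper bound) and must work for every $n$. Agents: each has memory and computational power; they are anonymous (no identifiers) and all execute the same deterministic protocol. They start at arbitrary, not necessarily distinct, nodes, cannot communicate explicitly and cannot mark nodes. Each agent $a_j$ has a consistent private orientation, i.e. a function $\lambda_j$ designating each port left or right with $\lambda_j(q_{i-})=\lambda_j(q_{k-})$ for all $i,k$. Chirality: all agents have the same orientation and are aware of it. Round: each active agent performs Look (it sees its own position within its node, i.e. whether it is on a port and which one, and the positions of the other agents at that node), Compute (from this snapshot and its memory it determines a direction in $\{left,right,nil\}$; if $nil$ it becomes inactive; otherwise it tries to access the corresponding port if not already there), and Move. Ports are accessed in mutual exclusion: an occupied port cannot be gained, and if several agents try the same port exactly one succeeds; an agent that fails sets $moved=false$ and becomes inactive. An agent on a port after computing moves to the other endpoint if the edge is present in this round (setting $moved=true$), and otherwise stays on the port (setting $moved=false$); in either case the port is denied to other agents in that round. Two agents crossing the same edge in opposite directions in the same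 round might not detect each other. $\mathcal{FSYNC}$: all agents are active in every round. Exploration is solved if within finite time every node is visited by at least one agent, in every execution (all initial positions and all adversary choices). It is with partial termination if moreover at least one agent enters, within finite time, a terminal state and no longer moves; a terminal state may be entered only after the ring has been explored. *)

theory Defs
  imports Main "HOL-Library.Multiset"
begin

text \<open>
  The nodes of a ring of size \<open>n\<close> are \<open>0, \<dots>, n - 1\<close>. The port of node \<open>v\<close> towards \<open>v - 1\<close> is
  \<open>(v, Minus)\<close>, the one towards \<open>v + 1\<close> is \<open>(v, Plus)\<close>; these names are global and are not visible
  to the agents. Edge \<open>e\<close> joins \<open>e\<close> and \<open>e + 1\<close> modulo \<open>n\<close>.
\<close>

datatype side = Minus | Plus
datatype dir = Left | Right
datatype label = Label1 | Label2

fun neighbour :: "nat \<Rightarrow> nat \<Rightarrow> side \<Rightarrow> nat" where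
  "neighbour n v Plus = (v + 1) mod n"
| "neighbour n v Minus = (v + n - 1) mod n"

fun edge :: "nat \<Rightarrow> nat \<Rightarrow> side \<Rightarrow> nat" where
  "edge n v Plus = v"
| "edge n v Minus = (v + n - 1) mod n"

text \<open>
  Visible port labels: the two ports of a node are labelled differently; different nodes need not
  be labelled consistently.
\<close>

type_synonym labelling = "nat \<Rightarrow> side \<Rightarrow> label"

definition port_labelling :: "nat \<Rightarrow> labelling \<Rightarrow> bool" where
  "port_labelling n lab \<longleftrightarrow> (\<forall>v<n. lab v Minus \<noteq> lab v Plus)"

type_synonym orientation = "nat \<Rightarrow> side \<Rightarrow> dir"

definition consistent_orientation :: "nat \<Rightarrow> orientation \<Rightarrow> bool" where
  "consistent_orientation n lam \<longleftrightarrow>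
     (\<forall>v<n. bij (lam v)) \<and> (\<forall>v<n. \<forall>w<n. lam v Minus = lam w Minus)"

definition common_chirality :: "nat \<Rightarrow> nat \<Rightarrow> (nat \<Rightarrow> orientation) \<Rightarrow> bool" where
  "common_chirality n k lam \<longleftrightarrow> (\<forall>i<k. \<forall>j<k. \<forall>v<n. lam i v = lam j v)"

text \<open>
  A snapshot is expressed in the orientation of the observing agent. A position within a node is
  \<open>None\<close> (not on a port) or \<open>Some d\<close> (on the port in direction \<open>d\<close>). As agents are anonymous, the
  other agents at the node are only seen as a multiset of positions.
\<close>

record snapshot =
  own_position :: "dir option"
  other_positions :: "dir option multiset"
  visible_label :: "dir \<Rightarrow> label"

text \<open>
  A deterministic protocol. The memory type \<open>'m\<close> is arbitrary; \<open>compute\<close> maps memory, the flag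
  \<open>moved\<close> and the snapshot to the new memory and a direction, where \<open>None\<close> is \<open>nil\<close>.
\<close>

record 'm algorithm =
  init :: 'm
  compute :: "'m \<Rightarrow> bool \<Rightarrow> snapshot \<Rightarrow> 'm \<times> dir option"
  terminal :: "'m \<Rightarrow> bool"

record 'm agent =
  node :: nat
  port :: "side option"
  mem :: 'm
  moved :: bool

text \<open>
  Agents are indexed by \<open>{..<k}\<close>. The indices serve the description of executions only; the
  protocol has no access to them. Values of a configuration outside \<open>{..<k}\<close> are irrelevant.
\<close>

type_synonym 'm config = "nat \<Rightarrow> 'm agent"

definition look :: "nat \<Rightarrow> labelling \<Rightarrow> (nat \<Rightarrow> orientation) \<Rightarrow> 'm config \<Rightarrow> nat \<Rightarrow> snapshot" where
  "look k lab lam c j =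
     (let v = node (c j) in
      \<lparr> own_position = map_option (lam j v) (port (c j)),
        other_positions =
          image_mset (\<lambda>i. map_option (lam j v) (port (c i)))
            (mset_set {i. i < k \<and> i \<noteq> j \<and> node (c i) = v}),
        visible_label = (\<lambda>d. lab v (inv (lam j v) d)) \<rparr>)"

definition acting :: "'m algorithm \<Rightarrow> nat set \<Rightarrow> 'm config \<Rightarrow> nat \<Rightarrow> bool" where
  "acting A act c j \<longleftrightarrow> j \<in> act \<and> \<not> terminal A (mem (c j))"

definition computed ::
    "'m algorithm \<Rightarrow> nat \<Rightarrow> labelling \<Rightarrow> (nat \<Rightarrow> orientation) \<Rightarrow> 'm config \<Rightarrow> nat \<Rightarrow> 'm \<times> dir option"
  where "computed A k lab lam c j = compute A (mem (c j)) (moved (c j)) (look k lab lam c j)"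

text \<open>
  The port aimed at after Compute. An agent that has just entered a terminal state no longer moves,
  so it is treated as having chosen \<open>nil\<close>.
\<close>

definition target ::
    "'m algorithm \<Rightarrow> nat \<Rightarrow> labelling \<Rightarrow> (nat \<Rightarrow> orientation) \<Rightarrow> 'm config \<Rightarrow> nat \<Rightarrow> side option"
  where "target A k lab lam c j =
     (let (m, d) = computed A k lab lam c j in
      if terminal A m then None else map_option (inv (lam j (node (c j)))) d)"

definition requests ::
    "'m algorithm \<Rightarrow> nat \<Rightarrow> labelling \<Rightarrow> (nat \<Rightarrow> orientation) \<Rightarrow> nat set \<Rightarrow> 'm config \<Rightarrow>
     nat \<Rightarrow> side \<Rightarrow> nat set"
  where "requests A k lab lam act c v s =
     {j. j < k \<and> acting A act c j \<and> node (c j) = v \<and>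
         target A k lab lam c j = Some s \<and> port (c j) \<noteq> Some s}"

definition occupied :: "nat \<Rightarrow> 'm config \<Rightarrow> nat \<Rightarrow> side \<Rightarrow> bool" where
  "occupied k c v s \<longleftrightarrow> (\<exists>j<k. node (c j) = v \<and> port (c j) = Some s)"

text \<open>
  Mutual exclusion: \<open>G\<close> is a possible set of agents that gain the port they request. A port occupied
  at the beginning of the round cannot be gained in that round.
\<close>

definition port_access ::
    "'m algorithm \<Rightarrow> nat \<Rightarrow> labelling \<Rightarrow> (nat \<Rightarrow> orientation) \<Rightarrow> nat set \<Rightarrow> 'm config \<Rightarrow>
     nat set \<Rightarrow> bool"
  where "port_access A k lab lam act c G \<longleftrightarrow>
     (\<forall>v s. let R = requests A k lab lam act c v s in
        if occupied k c v s \<or> R = {} then G \<inter> R = {} else (\<exists>j. G \<inter> R = {j}))"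

text \<open>
  \<open>miss\<close> is the edge missing in the round, if any. An agent choosing \<open>nil\<close>, failing to gain a port,
  or not acting keeps its position, possibly on a port.
\<close>

definition agent_step ::
    "'m algorithm \<Rightarrow> nat \<Rightarrow> nat \<Rightarrow> labelling \<Rightarrow> (nat \<Rightarrow> orientation) \<Rightarrow> nat set \<Rightarrow> nat option \<Rightarrow>
     nat set \<Rightarrow> 'm config \<Rightarrow> nat \<Rightarrow> 'm agent"
  where "agent_step A k n lab lam act miss G c j =
     (if \<not> acting A act c j then c j
      else let a = c j; a' = a\<lparr>mem := fst (computed A k lab lam c j)\<rparr> in
        case target A k lab lam c j of
          None \<Rightarrow> a'
        | Some s \<Rightarrow>
            if port a = Some s \<or> j \<in> G then
              if miss = Some (edge n (node a) s)
              then a'\<lparr>port := Some s, moved := False\<rparr>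
              else a'\<lparr>node := neighbour n (node a) s, port := None, moved := True\<rparr>
            else a'\<lparr>moved := False\<rparr>)"

definition round_step ::
    "'m algorithm \<Rightarrow> nat \<Rightarrow> nat \<Rightarrow> labelling \<Rightarrow> (nat \<Rightarrow> orientation) \<Rightarrow> nat set \<Rightarrow> nat option \<Rightarrow>
     'm config \<Rightarrow> 'm config \<Rightarrow> bool"
  where "round_step A k n lab lam act miss c c' \<longleftrightarrow>
     (\<exists>G. port_access A k lab lam act c G \<and>
          (\<forall>j<k. c' j = agent_step A k n lab lam act miss G c j))"

definition initial :: "'m algorithm \<Rightarrow> nat \<Rightarrow> nat \<Rightarrow> 'm config \<Rightarrow> bool" where
  "initial A k n c \<longleftrightarrow>
     (\<forall>j<k. node (c j) < n \<and> port (c j) = None \<and> mem (c j) = init A \<and> \<not> moved (c j))"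

datatype scheduler = FSYNC | SSYNC

text \<open>\<open>act t\<close> is the set of agents active in round \<open>t\<close>. \<open>SSYNC\<close> is the general fair scheduler.\<close>

fun admissible_schedule :: "scheduler \<Rightarrow> nat \<Rightarrow> (nat \<Rightarrow> nat set) \<Rightarrow> bool" where
  "admissible_schedule FSYNC k act \<longleftrightarrow> (\<forall>t. {..<k} \<subseteq> act t)"
| "admissible_schedule SSYNC k act \<longleftrightarrow> (\<forall>j<k. \<forall>t. \<exists>t'\<ge>t. j \<in> act t')"

definition execution ::
    "bool \<Rightarrow> scheduler \<Rightarrow> 'm algorithm \<Rightarrow> nat \<Rightarrow> nat \<Rightarrow> (nat \<Rightarrow> 'm config) \<Rightarrow> bool"
  where "execution chirality sched A k n c \<longleftrightarrow>
     (\<exists>lab lam act miss.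
        port_labelling n lab \<and>
        (\<forall>j<k. consistent_orientation n (lam j)) \<and>
        (chirality \<longrightarrow> common_chirality n k lam) \<and>
        admissible_schedule sched k act \<and>
        (\<forall>t e. miss t = Some e \<longrightarrow> e < n) \<and>
        initial A k n (c 0) \<and>
        (\<forall>t. round_step A k n lab lam (act t) (miss t) (c t) (c (Suc t))))"

definition explored_by :: "nat \<Rightarrow> nat \<Rightarrow> (nat \<Rightarrow> 'm config) \<Rightarrow> nat \<Rightarrow> bool" where
  "explored_by k n c T \<longleftrightarrow> (\<forall>v<n. \<exists>t\<le>T. \<exists>j<k. node (c t j) = v)"

text \<open>
  Exploration with partial termination of all rings (\<open>n \<ge> 3\<close>), by one algorithm that is
  independent of \<open>n\<close>. If \<open>chirality\<close> is \<open>False\<close>, orientations are arbitrary.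
\<close>

definition solves_exploration_partial_termination ::
    "bool \<Rightarrow> scheduler \<Rightarrow> nat \<Rightarrow> 'm algorithm \<Rightarrow> bool"
  where "solves_exploration_partial_termination chirality sched k A \<longleftrightarrow>
     (\<forall>n\<ge>3. \<forall>c. execution chirality sched A k n c \<longrightarrow>
        (\<exists>T. explored_by k n c T) \<and>
        (\<exists>j<k. \<exists>T. \<forall>t\<ge>T. terminal A (mem (c t j)) \<and>
            node (c t j) = node (c T j) \<and> port (c t j) = port (c T j)) \<and>
        (\<forall>t. \<forall>j<k. terminal A (mem (c t j)) \<longrightarrow> explored_by k n c t))"

end

theory Submission
  imports Defs
begin

text \<open>
  Let no edge ever be missing and start the agents at pairwise distinct nodes of a ring with
  consistent labels and orientations. All agents then see the same snapshot, hence all make the same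
  move, so they stay at pairwise distinct nodes and never meet. The memory of an agent after \<open>t\<close> rounds
  therefore does not depend on the size of the ring, and neither does the round \<open>T\<close> by which the
  agents have terminated. Since \<open>k\<close> agents visit at most \<open>k (T + 1)\<close> nodes up to round \<open>T\<close>, they
  terminate without having explored a larger ring.
\<close>

fun std_orientation :: "side \<Rightarrow> dir" where
  "std_orientation Minus = Left"
| "std_orientation Plus = Right"

fun std_label :: "side \<Rightarrow> label" where
  "std_label Minus = Label1"
| "std_label Plus = Label2"

lemma bij_std_orientation: "bij std_orientation"
proof (rule bijI)
  show "inj std_orientation"
  proof (rule injI)
    fix x y assume "std_orientation x = std_orientation y"
    then show "x = y" by (cases x; cases y) auto
  qed
  show "surj std_orientation"
  proof (rule surjI)
    show "std_orientation (case d of Left \<Rightarrow> Minus | Right \<Rightarrow> Plus) = d" for d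
      by (cases d) auto
  qed
qed

definition lone_snapshot :: snapshot where
  "lone_snapshot =
     \<lparr> own_position = None, other_positions = {#},
       visible_label = (\<lambda>d. std_label (inv std_orientation d)) \<rparr>"

text \<open>One round of an agent with nobody else at its node and no edge missing. Every port
  request then succeeds and the move goes through, so no other agent has to be mentioned.\<close>

definition lone_step :: "'m algorithm \<Rightarrow> nat \<Rightarrow> 'm agent \<Rightarrow> 'm agent" where
  "lone_step A n a =
     (if terminal A (mem a) then a
      else let (m, d) = compute A (mem a) (moved a) lone_snapshot in
        case if terminal A m then None else d of
          None \<Rightarrow> a\<lparr>mem := m\<rparr>
        | Some d' \<Rightarrow> a\<lparr>node := neighbour n (node a) (inv std_orientation d'),
                     port := None, mem := m, moved := True\<rparr>)"

text \<open>The last argument has two roles: it is the start node and, when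
  \<open>lone_run A n t\<close> is read as a configuration, the index of the agent.\<close>

primrec lone_run :: "'m algorithm \<Rightarrow> nat \<Rightarrow> nat \<Rightarrow> nat \<Rightarrow> 'm agent" where
  "lone_run A n 0 v = \<lparr>node = v, port = None, mem = init A, moved = False\<rparr>"
| "lone_run A n (Suc t) v = lone_step A n (lone_run A n t v)"

lemma neighbour_less: "0 < n \<Longrightarrow> neighbour n v s < n"
  by (cases s) auto

lemma neighbour_inj:
  assumes "v < n" "w < n" "neighbour n v s = neighbour n w s"
  shows "v = w"
proof (cases s)
  case Plus
  with assms show ?thesis
    by (cases "v + 1 = n"; cases "w + 1 = n") auto
next
  case Minus
  have "(u + n - 1) mod n = (if u = 0 then n - 1 else u - 1)" if "u < n" for u
  proof (cases u)
    case (Suc u')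
    then have "u + n - 1 = u' + n" by simp
    then show ?thesis using Suc that by simp
  qed (use that in simp)
  with Minus assms show ?thesis
    by (auto split: if_splits)
qed

text \<open>\<open>lone_snapshot\<close> is constant, so position and ring size influence only the
  new node; hence \<open>n\<close> and \<open>n'\<close> may differ.\<close>

lemma lone_step_cong:
  assumes "mem a = mem b" "moved a = moved b"
  shows "mem (lone_step A n a) = mem (lone_step A n' b)"
    and "moved (lone_step A n a) = moved (lone_step A n' b)"
  using assms by (auto simp: lone_step_def split: prod.split option.split)

text \<open>Taken with \<open>n = n'\<close> it compares two agents of one run; taken with
  \<open>v = w\<close> it carries a terminal state over to a ring of another size.\<close>

lemma lone_run_uniform:
  "mem (lone_run A n t v) = mem (lone_run A n' t w) \<and>
   moved (lone_run A n t v) = moved (lone_run A n' t w)"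
  by (induction t) (simp_all add: lone_step_cong[of "lone_run A n _ v" "lone_run A n' _ w" A n n'])

lemma port_lone_run: "port (lone_run A n t v) = None"
  by (induction t) (auto simp: lone_step_def split: prod.split option.split)

lemma node_lone_run_less: "v < n \<Longrightarrow> node (lone_run A n t v) < n"
  by (induction t) (auto simp: lone_step_def neighbour_less split: prod.split option.split)

text \<open>Equal memories and flags lead to equal decisions: both agents stay or both shift to the
  same side, and a shift is injective on the ring.\<close>

lemma node_lone_run_inj:
  assumes "v < n" "w < n" "node (lone_run A n t v) = node (lone_run A n t w)"
  shows "v = w"
  using assms(3)
proof (induction t)
  case (Suc t)
  let ?a = "lone_run A n t v" and ?b = "lone_run A n t w"
  have "mem ?a = mem ?b" "moved ?a = moved ?b"
    using lone_run_uniform by blast+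
  moreover have "node ?a < n" "node ?b < n"
    using assms node_lone_run_less by blast+
  ultimately have "node ?a = node ?b"
    using Suc.prems
    by (auto simp: lone_step_def split: prod.splits option.splits if_splits dest: neighbour_inj)
  then show ?case by (rule Suc.IH)
qed simp

context
  fixes A :: "'m algorithm" and k n :: nat
  \<comment> \<open>This makes every agent index a valid start node.\<close>
  assumes agents_le: "k \<le> n"
begin

abbreviation "lone_lab \<equiv> \<lambda>v::nat. std_label"
abbreviation "lone_ori \<equiv> \<lambda>(j::nat) (v::nat). std_orientation"

lemma look_lone_run:
  assumes "j < k"
  shows "look k lone_lab lone_ori (lone_run A n t) j = lone_snapshot"
proof -
  have alone: "{i. i < k \<and> i \<noteq> j \<and> node (lone_run A n t i) = node (lone_run A n t j)} = {}"
    using assms agents_le node_lone_run_inj[of _ n j A t] by auto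
  show ?thesis
    unfolding look_def Let_def alone
    by (simp add: lone_snapshot_def port_lone_run)
qed

lemma round_step_lone_run:
  "round_step A k n lone_lab lone_ori UNIV None (lone_run A n t) (lone_run A n (Suc t))"
proof -
  let ?c = "lone_run A n t"
  \<comment> \<open>All agents may gain their ports at once: no port is occupied, and distinct nodes
    leave at most one request per port.\<close>
  have "port_access A k lone_lab lone_ori UNIV ?c UNIV"
  proof -
    have "\<exists>j. requests A k lone_lab lone_ori UNIV ?c v s = {j}"
      if "requests A k lone_lab lone_ori UNIV ?c v s \<noteq> {}" for v s
    proof -
      from that obtain j where j: "j \<in> requests A k lone_lab lone_ori UNIV ?c v s" by blast
      have "i = j" if "i \<in> requests A k lone_lab lone_ori UNIV ?c v s" for i
        using that j agents_le node_lone_run_inj[of i n j A t] by (simp add: requests_def)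
      with j show ?thesis by blast
    qed
    then show ?thesis
      by (simp add: port_access_def occupied_def port_lone_run)
  qed
  moreover have "lone_run A n (Suc t) j =
      agent_step A k n lone_lab lone_ori UNIV None UNIV ?c j" if "j < k" for j
    using that
    by (auto simp: agent_step_def acting_def target_def computed_def look_lone_run lone_step_def
        Let_def split: prod.split option.split)
  ultimately show ?thesis
    unfolding round_step_def by blast
qed

text \<open>Activating everybody in every round is admissible for both schedulers, and the shared
  orientation satisfies chirality, so one run serves all parameters.\<close>

lemma execution_lone_run: "execution chirality sched A k n (lone_run A n)"
  unfolding execution_def
proof (intro exI conjI)
  show "port_labelling n lone_lab"
    by (simp add: port_labelling_def)
  show "\<forall>j<k. consistent_orientation n (lone_ori j)"
    by (simp add: consistent_orientation_def bij_std_orientation)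
  show "chirality \<longrightarrow> common_chirality n k lone_ori"
    by (simp add: common_chirality_def)
  show "admissible_schedule sched k (\<lambda>_. UNIV)"
    by (cases sched) auto
  show "\<forall>t e. (\<lambda>_. None) t = Some e \<longrightarrow> e < n"
    by simp
  show "initial A k n (lone_run A n 0)"
    using agents_le by (simp add: initial_def)
  show "\<forall>t. round_step A k n lone_lab lone_ori ((\<lambda>_. UNIV) t) ((\<lambda>_. None) t)
      (lone_run A n t) (lone_run A n (Suc t))"
    using round_step_lone_run by simp
qed

end

lemma explored_by_le:
  assumes "explored_by k n c T"
  shows "n \<le> (T + 1) * k"
proof -
  have "{..<n} \<subseteq> (\<lambda>(t, j). node (c t j)) ` ({..T} \<times> {..<k})"
    using assms by (fastforce simp: explored_by_def)
  then have "card {..<n} \<le> card ({..T} \<times> {..<k})"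
    by (rule surj_card_le[rotated]) simp
  then show ?thesis by simp
qed

theorem theorem2:
  fixes k :: nat and chirality :: bool and sched :: scheduler
  shows "\<not> (\<exists>A :: 'm algorithm. solves_exploration_partial_termination chirality sched k A)"
proof
  assume "\<exists>A :: 'm algorithm. solves_exploration_partial_termination chirality sched k A"
  then obtain A :: "'m algorithm"
    where A: "solves_exploration_partial_termination chirality sched k A" ..
  \<comment> \<open>The size \<open>k + 3\<close> is large enough both for a ring and for distinct
    start nodes.\<close>
  have "execution chirality sched A k (k + 3) (lone_run A (k + 3))"
    by (rule execution_lone_run) simp
  with A obtain j T where j: "j < k" and "terminal A (mem (lone_run A (k + 3) T j))"
    unfolding solves_exploration_partial_termination_def by (meson le_add2 order_refl)
  \<comment> \<open>Chosen to exceed the bound of \<open>explored_by_le\<close> at round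
    \<open>T\<close>; it is also at least 3 and at least \<open>k\<close>.\<close>
  define n where "n = (T + 1) * k + 3"
  have "terminal A (mem (lone_run A n T j))"
    using \<open>terminal A (mem (lone_run A (k + 3) T j))\<close> lone_run_uniform by metis
  moreover have "execution chirality sched A k n (lone_run A n)"
    by (rule execution_lone_run) (simp add: n_def)
  ultimately have "explored_by k n (lone_run A n) T"
    using A j unfolding solves_exploration_partial_termination_def n_def by (meson le_add2)
  then have "n \<le> (T + 1) * k"
    by (rule explored_by_le)
  then show False
    by (simp add: n_def)
qed

end
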